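(* Suppose each loss $\phi_i$ is $L$-Lipschitz for some $L>0$, i.e. $|\phi_i(a)-\phi_i(c)|\le L|a-c|$ for all $a,c\in\mathbb{R}$. Suppose that the positive vector $v\in\mathbb{R}^n$ satisfies the ESO inequality (given in the context) for the sampling $\hat S$, and let $(\alpha^{(t)})_{t\ge 0}$ be the random iterates of mini-batch SDCA (given in the context) run with this $\hat S$ and $v$. Write $b=\mathbb{E}[|\hat S|]$ and $$G=4L^2\,\frac{\sum_{i=1}^n v_i}{n},$$ let $\alpha^*$ be a maximizer of $\mathcal{D}$, and let $\epsilon_D^{(0)}=\mathcal{D}(\alpha^* )-\mathcal{D}(\alpha^{(0)})$. Let $\epsilon_{\mathcal G}>0$ be a desired duality gap. If the integers $t_0,T_0,T$ satisfy $$t_0\ge\max\left(0,\left\lceil\frac{n}{b}\log\left(\frac{2\lambda n\,\epsilon_D^{(0)}}{G}\right)\right\rceil\right),\qquad T_0\ge t_0+\frac1b\left(\frac{4G}{\lambda\epsilon_{\mathcal G}}-2n\right)_+,$$ $$T\ge T_0+\max\left\{\left\lceil\frac nb\right\rceil,\ \frac1b\,\frac{G}{\lambda\epsilon_{\mathcal G}}\right\},$$ then $\mathbb{E}[\mathcal{P}(\bar w)-\mathcal{D}(\bar\alpha)]\le\epsilon_{\mathcal G}$, where $\bar\alpha=\frac{1}{T-T_0}\sum_{t=T_0}^{T-1}\alpha^{(t)}$ and $\bar w=w_{\bar\alpha}$. Moreover, for every $t\ge T_0$, $$\mathbb{E}[\mathcal{D}(\alpha^* )-\mathcal{D}(\alpha^{(t)})]\le\tfrac12\epsilon_{\mathcal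 G}.$$
   Context: Setting. Let $x_1,\dots,x_n\in\mathbb{R}^d$ be training examples, $X=[x_1,\dots,x_n]^T\in\mathbb{R}^{n\times d}$, and $\lambda>0$. Let $\phi_1,\dots,\phi_n:\mathbb{R}\to\mathbb{R}$ be convex loss functions that are non-negative and satisfy $\phi_i(0)\le 1$ for all $i$. The primal objective is $\mathcal{P}(w)=\frac1n\sum_{i=1}^n\phi_i(w^Tx_i)+\frac{\lambda}{2}\|w\|^2$ for $w\in\mathbb{R}^d$, to be minimized. The dual objective is $\mathcal{D}(\alpha)=-\frac1n\sum_{i=1}^n\phi_i^*(-\alpha_i)-\frac{\lambda}{2}\left\|\frac{1}{\lambda n}X^T\alpha\right\|^2$ for $\alpha\in\mathbb{R}^n$, to be maximized, where $\phi_i^*(u)=\sup_{z}(zu-\phi_i(z))\in\mathbb{R}\cup\{+\infty\}$ is the convex conjugate. For $\alpha\in\mathbb{R}^n$ set $w_\alpha=\frac{1}{\lambda n}X^T\alpha$. Sampling. $\hat S$ is a random subset of $\{1,\dots,n\}$ with uniform marginals, i.e. $\mathbb{P}(i\in\hat S)$ is the same for all $i$; $b=\mathbb{E}[|\hat S|]>0$, so $\mathbb{P}(i\in\hat S)=b/n$. For $t\in\mathbb{R}^n$ and $S\subseteq\{1,\dots,n\}$, $t_{[S]}\in\mathbb{R}^n$ has $i$-th coordinate $t_i$ if $i\in S$ and $0$ otherwise. For a positive vector $v\in\mathbb{R}^n$, $\|t\|_v^2=\sum_{i=1}^n v_it_i^2$. ESO inequality (expected separable overapproximation) for $v$ and $\hat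 S$: for all $\alpha,t\in\mathbb{R}^n$, $$\mathbb{E}\left[\left\|\tfrac{1}{\lambda n}X^T(\alpha+t_{[\hat S]})\right\|^2\right]\le\|w_\alpha\|^2+\frac{b}{n}\left(\left\|\tfrac{1}{\lambda n}t\right\|_v^2+\frac{2}{\lambda n}t^TXw_\alpha\right).$$ Mini-batch SDCA (with inputs $\hat S$, $v$). Set $\alpha^{(0)}=0\in\mathbb{R}^n$. For $t=0,1,2,\dots$: draw $S_t$ from the distribution of $\hat S$, independently of the past; for each $i\in S_t$ set $\alpha_i^{(t+1)}=\alpha_i^{(t)}+\Delta\alpha_i^{(t)}$, where $$\Delta\alpha_i^{(t)}=\arg\max_{\delta\in\mathbb{R}}\left\{-\phi_i^*(-\alpha_i^{(t)}-\delta)-\frac{1}{2\lambda n}v_i\delta^2-w_{\alpha^{(t)}}^Tx_i\,\delta\right\};$$ for $i\notin S_t$ set $\alpha_i^{(t+1)}=\alpha_i^{(t)}$. Notation: $(a)_+=\max\{a,0\}$; if $\epsilon_D^{(0)}=0$ the logarithm is read as $-\infty$, so the condition on $t_0$ is $t_0\ge 0$. *)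

theory Defs
  imports "HOL-Probability.Probability"
begin

text \<open>
  The data matrix is \<open>X :: real^'d^'n\<close>; its rows are the training examples, so the number of
  examples is \<open>CARD('n)\<close>.
\<close>

definition conjugate :: "(real \<Rightarrow> real) \<Rightarrow> real \<Rightarrow> ereal" where
  "conjugate f u = (SUP z. ereal (z * u - f z))"

definition primal :: "real^'d^'n \<Rightarrow> real \<Rightarrow> ('n \<Rightarrow> real \<Rightarrow> real) \<Rightarrow> real^'d \<Rightarrow> real" where
  "primal X lam \<phi> w =
     1 / real CARD('n) * (\<Sum>i\<in>UNIV. \<phi> i (w \<bullet> row i X)) + lam / 2 * (norm w)\<^sup>2"

definition primal_of_dual :: "real^'d^'n \<Rightarrow> real \<Rightarrow> real^'n \<Rightarrow> real^'d" where
  "primal_of_dual X lam \<alpha> = (1 / (lam * real CARD('n))) *\<^sub>R (transpose X *v \<alpha>)"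

text \<open>
  A conjugate of a real-valued function is never \<open>-\<infinity>\<close>, so the sum below never mixes
  infinities of opposite sign and \<open>dual X lam \<phi> \<alpha>\<close> is never \<open>\<infinity>\<close>.
\<close>

definition dual :: "real^'d^'n \<Rightarrow> real \<Rightarrow> ('n \<Rightarrow> real \<Rightarrow> real) \<Rightarrow> real^'n \<Rightarrow> ereal" where
  "dual X lam \<phi> \<alpha> =
     - (ereal (1 / real CARD('n)) * (\<Sum>i\<in>UNIV. conjugate (\<phi> i) (- (\<alpha> $ i))))
     - ereal (lam / 2 * (norm (primal_of_dual X lam \<alpha>))\<^sup>2)"

definition vrestrict :: "real^'n \<Rightarrow> 'n set \<Rightarrow> real^'n" where
  "vrestrict t S = (\<chi> i. if i \<in> S then t $ i else 0)"

definition weighted_sqnorm :: "real^'n \<Rightarrow> real^'n \<Rightarrow> real" where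
  "weighted_sqnorm v t = (\<Sum>i\<in>UNIV. v $ i * (t $ i)\<^sup>2)"

definition uniform_sampling :: "'n set pmf \<Rightarrow> bool" where
  "uniform_sampling q \<longleftrightarrow>
     (\<forall>i j. measure_pmf.prob q {S. i \<in> S} = measure_pmf.prob q {S. j \<in> S})"

definition batch_size :: "'n set pmf \<Rightarrow> real" where
  "batch_size q = measure_pmf.expectation q (\<lambda>S. real (card S))"

definition ESO :: "real^'d^'n \<Rightarrow> real \<Rightarrow> 'n set pmf \<Rightarrow> real^'n \<Rightarrow> bool" where
  "ESO X lam q v \<longleftrightarrow>
     (\<forall>\<alpha> t.
        measure_pmf.expectation q (\<lambda>S. (norm (primal_of_dual X lam (\<alpha> + vrestrict t S)))\<^sup>2)
        \<le> (norm (primal_of_dual X lam \<alpha>))\<^sup>2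
          + batch_size q / real CARD('n) *
            (weighted_sqnorm v ((1 / (lam * real CARD('n))) *\<^sub>R t)
             + 2 / (lam * real CARD('n)) * (t \<bullet> (X *v primal_of_dual X lam \<alpha>))))"

definition coord_objective ::
  "real^'d^'n \<Rightarrow> real \<Rightarrow> ('n \<Rightarrow> real \<Rightarrow> real) \<Rightarrow> real^'n \<Rightarrow> real^'n \<Rightarrow> 'n \<Rightarrow> real \<Rightarrow> ereal" where
  "coord_objective X lam \<phi> v \<alpha> i \<delta> =
     - conjugate (\<phi> i) (- (\<alpha> $ i) - \<delta>)
     - ereal (1 / (2 * lam * real CARD('n)) * (v $ i) * \<delta>\<^sup>2)
     - ereal ((primal_of_dual X lam \<alpha> \<bullet> row i X) * \<delta>)"

definition coord_step ::
  "real^'d^'n \<Rightarrow> real \<Rightarrow> ('n \<Rightarrow> real \<Rightarrow> real) \<Rightarrow> real^'n \<Rightarrow> real^'n \<Rightarrow> 'n \<Rightarrow> real" where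
  "coord_step X lam \<phi> v \<alpha> i = arg_max (coord_objective X lam \<phi> v \<alpha> i) (\<lambda>_. True)"

text \<open>
  The dual iterates as a function of the realised sequence \<open>S\<close> of mini-batches; all coordinates
  in \<open>S t\<close> are updated simultaneously from the same old iterate.
\<close>

primrec sdca ::
  "real^'d^'n \<Rightarrow> real \<Rightarrow> ('n \<Rightarrow> real \<Rightarrow> real) \<Rightarrow> real^'n \<Rightarrow> (nat \<Rightarrow> 'n set) \<Rightarrow> nat \<Rightarrow> real^'n" where
  "sdca X lam \<phi> v S 0 = 0"
| "sdca X lam \<phi> v S (Suc t) =
     (\<chi> i. if i \<in> S t
           then sdca X lam \<phi> v S t $ i + coord_step X lam \<phi> v (sdca X lam \<phi> v S t) i
           else sdca X lam \<phi> v S t $ i)"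

definition sdca_average ::
  "real^'d^'n \<Rightarrow> real \<Rightarrow> ('n \<Rightarrow> real \<Rightarrow> real) \<Rightarrow> real^'n \<Rightarrow> (nat \<Rightarrow> 'n set) \<Rightarrow> nat \<Rightarrow> nat \<Rightarrow> real^'n" where
  "sdca_average X lam \<phi> v S T0 T =
     (1 / (real T - real T0)) *\<^sub>R (\<Sum>t\<in>{T0..<T}. sdca X lam \<phi> v S t)"

text \<open>
  The expectation of an extended-real random variable, as the difference of the integrals of its
  positive and negative parts (\<open>e2ennreal\<close> maps negative values to 0). In \<open>ereal\<close> we have
  \<open>\<infinity> - \<infinity> = \<infinity>\<close>, so a finite upper bound on an expectation is false, not vacuous, in the
  undefined case.
\<close>

definition ereal_expectation :: "'a measure \<Rightarrow> ('a \<Rightarrow> ereal) \<Rightarrow> ereal" where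
  "ereal_expectation M f =
     enn2ereal (\<integral>\<^sup>+\<omega>. e2ennreal (f \<omega>) \<partial>M) - enn2ereal (\<integral>\<^sup>+\<omega>. e2ennreal (- f \<omega>) \<partial>M)"

text \<open>
  Initial dual suboptimality. It is used only for a maximizer \<open>\<alpha>s\<close> of the dual and non-negative
  losses, when both dual values are finite.
\<close>

definition initial_dual_gap ::
  "real^'d^'n \<Rightarrow> real \<Rightarrow> ('n \<Rightarrow> real \<Rightarrow> real) \<Rightarrow> real^'n \<Rightarrow> real" where
  "initial_dual_gap X lam \<phi> \<alpha>s = real_of_ereal (dual X lam \<phi> \<alpha>s - dual X lam \<phi> 0)"

end

theory Submission
  imports Defs
begin

text \<open>
  Comparing the exact coordinate maximisers with a move by a fraction \<open>s\<close> towards negative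
  subgradients of the losses, the ESO inequality bounds the expected one-step dual increase below by
  \<open>(b/n) (s gap - s\<^sup>2 G / (2 \<lambda> n))\<close>. Since the gap dominates the dual suboptimality, \<open>s = 1\<close> gives
  linear convergence down to \<open>G / (\<lambda> n)\<close> by time \<open>t0\<close>, and then \<open>s = 2 n / (2 n + b (t - t0))\<close> gives the
  rate \<open>2 G / (\<lambda> (2 n + b (t - t0)))\<close>. Telescoping from \<open>T0\<close> to \<open>T\<close> with \<open>s = n / (b (T - T0))\<close>
  bounds the average gap, hence by convexity the gap at the averaged iterate.
\<close>

section \<open>Convex conjugates on their effective domain\<close>

text \<open>The dual is extended-valued, and \<open>arg_max\<close> is a choice operator that says
  nothing until a maximum is known to be attained. Lipschitz losses remove both problems: their
  conjugates are finite only inside [-L, L], so each coordinate problem has a bounded domain and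
  attains its maximum, and every iterate started at 0 stays where all conjugates are finite. From
  there on the argument is real-valued. That interval has diameter 2 L, which is the origin of the
  factor 4 L^2 in \<open>G\<close>. The fractions s come from optimisation. At suboptimality e, the
  bound on the next suboptimality is minimised by s = lam n e / G. This equals the admissible limit
  1 exactly at e = G / (lam n), the level where the burn-in ends, and it equals 2 n / (2 n + b k)
  when e is 2 G / (lam (2 n + b k)). In the averaging phase, s is instead chosen to make the weight
  (b/n) s of each gap equal to 1 / (T - T0). A mini-batch takes finitely many values, so each
  iterate is a function on a finite set of histories, and measurability and integrability come for
  free.\<close>

definition conjugate_domain :: "(real \<Rightarrow> real) \<Rightarrow> real set" where
  "conjugate_domain f = {u. bdd_above (range (\<lambda>z. z * u - f z))}"

text \<open>Meaningful only on \<open>conjugate_domain f\<close>; elsewhere the real supremum is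
  taken over an unbounded set and its value is arbitrary.\<close>

definition real_conjugate :: "(real \<Rightarrow> real) \<Rightarrow> real \<Rightarrow> real" where
  "real_conjugate f u = (SUP z. z * u - f z)"

lemma conjugate_domainI:
  assumes "\<And>z. z * u - f z \<le> r"
  shows "u \<in> conjugate_domain f"
  using assms by (auto simp: conjugate_domain_def bdd_above_def)

lemma real_conjugate_le:
  assumes "\<And>z. z * u - f z \<le> r"
  shows "real_conjugate f u \<le> r"
  unfolding real_conjugate_def using assms by (intro cSUP_least) auto

lemma real_conjugate_ge:
  assumes "u \<in> conjugate_domain f"
  shows "z * u - f z \<le> real_conjugate f u"
  unfolding real_conjugate_def using assms
  by (intro cSUP_upper) (auto simp: conjugate_domain_def)

lemma conjugate_eq_real:
  assumes "u \<in> conjugate_domain f"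
  shows "conjugate f u = ereal (real_conjugate f u)"
proof (rule antisym)
  show "conjugate f u \<le> ereal (real_conjugate f u)"
    unfolding conjugate_def using real_conjugate_ge[OF assms] by (intro SUP_least) simp
  have le: "ereal (z * u - f z) \<le> conjugate f u" for z
    unfolding conjugate_def by (rule SUP_upper) simp
  show "ereal (real_conjugate f u) \<le> conjugate f u"
  proof (cases "conjugate f u")
    case (real r)
    then show ?thesis using le by (auto intro: real_conjugate_le)
  next
    case MInf
    then show ?thesis using le[of 0] by simp
  qed simp
qed

lemma conjugate_eq_infinity:
  assumes "u \<notin> conjugate_domain f"
  shows "conjugate f u = \<infinity>"
proof -
  have le: "ereal (z * u - f z) \<le> conjugate f u" for z
    unfolding conjugate_def by (rule SUP_upper) simp
  show ?thesis
  proof (cases "conjugate f u")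
    case (real r)
    then have "u \<in> conjugate_domain f"
      using le by (intro conjugate_domainI[of _ _ r]) simp
    then show ?thesis using assms by simp
  next
    case MInf
    then show ?thesis using le[of 0] by simp
  qed simp
qed

text \<open>A conjugate is a supremum of affine functions of \<open>u\<close>. One inequality serves
  both claims: its right-hand side is an upper bound for all \<open>z\<close>, so the combination
  lies in the domain, and the supremum is at most that bound.\<close>

lemma convex_conjugate_domain: "convex (conjugate_domain f)"
  and convex_on_real_conjugate: "convex_on (conjugate_domain f) (real_conjugate f)"
proof -
  have le: "z * (s * x + t * y) - f z \<le> s * real_conjugate f x + t * real_conjugate f y"
    if "x \<in> conjugate_domain f" "y \<in> conjugate_domain f" "0 \<le> s" "0 \<le> t" "s + t = 1"
    for x y s t z
  proof -
    have "z * (s * x + t * y) - f z = s * (z * x - f z) + t * (z * y - f z) + (s + t - 1) * f z"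
      by (simp add: algebra_simps)
    also have "\<dots> \<le> s * real_conjugate f x + t * real_conjugate f y"
      using that real_conjugate_ge[of x f z] real_conjugate_ge[of y f z]
      by (simp add: add_mono mult_left_mono)
    finally show ?thesis .
  qed
  show cv: "convex (conjugate_domain f)"
    unfolding convex_def using le by (auto intro!: conjugate_domainI)
  show "convex_on (conjugate_domain f) (real_conjugate f)"
    unfolding convex_on_def using le cv by (auto intro!: real_conjugate_le)
qed

text \<open>An affine minorant of slope \<open>u\<close> touching \<open>f\<close> at
  \<open>z\<close> makes \<open>z\<close> a maximiser of \<open>y * u - f y\<close>: equality in the
  Fenchel-Young inequality. Its slope is the target of the comparison move in
  \<open>coord_step_gain\<close>.\<close>

lemma real_conjugate_subgradient:
  fixes f :: "real \<Rightarrow> real"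
  assumes "convex_on UNIV f"
  obtains u where "u \<in> conjugate_domain f" "real_conjugate f u = z * u - f z"
proof -
  obtain u where u: "\<And>y. f z + u * (y - z) \<le> f y"
    using convex_le_Inf_differential[OF assms, of z] by auto
  then have le: "y * u - f y \<le> z * u - f z" for y
    using u[of y] by (simp add: algebra_simps)
  then have dom: "u \<in> conjugate_domain f" by (rule conjugate_domainI)
  moreover have "real_conjugate f u = z * u - f z"
    using real_conjugate_le[of u f, OF le] real_conjugate_ge[OF dom, of z] by simp
  ultimately show ?thesis using that by blast
qed

text \<open>Since \<open>f\<close> grows at most with slope \<open>L\<close>, a larger slope
  \<open>u\<close> would make \<open>z * u - f z\<close> unbounded along the ray in the direction of
  \<open>sgn u\<close>.\<close>

lemma abs_le_Lipschitz_if_conjugate_domain: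
  assumes dom: "u \<in> conjugate_domain f"
    and lip: "\<And>a c. \<bar>f a - f c\<bar> \<le> L * \<bar>a - c\<bar>"
  shows "\<bar>u\<bar> \<le> L"
proof (rule ccontr)
  assume "\<not> \<bar>u\<bar> \<le> L"
  then have pos: "\<bar>u\<bar> - L > 0" by simp
  \<comment> \<open>Far enough along the ray that the guaranteed growth
    \<open>k * (\<bar>u\<bar> - L)\<close> exceeds \<open>real_conjugate f u + f 0\<close> by at
    least 1.\<close>
  define k where "k = (\<bar>real_conjugate f u + f 0\<bar> + 1) / (\<bar>u\<bar> - L)"
  have k: "k > 0" "k * (\<bar>u\<bar> - L) = \<bar>real_conjugate f u + f 0\<bar> + 1"
    unfolding k_def using pos by auto
  have "L \<ge> 0" using lip[of 1 0] abs_ge_zero[of "f 1 - f 0"] by simp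
  then have "u \<noteq> 0" using pos by auto
  have "f (k * sgn u) - f 0 \<le> L * k"
    using lip[of "k * sgn u" 0] k \<open>u \<noteq> 0\<close> by (simp add: abs_mult)
  moreover have "k * sgn u * u = k * \<bar>u\<bar>" by (simp add: abs_sgn mult.commute mult.left_commute)
  ultimately have "k * \<bar>u\<bar> - L * k - f 0 \<le> real_conjugate f u"
    using real_conjugate_ge[OF dom, of "k * sgn u"] by linarith
  then show False using k(2) by (simp add: algebra_simps)
qed

text \<open>Minimising the height over a truncated epigraph, a compact set, avoids semicontinuity.\<close>

lemma real_conjugate_perturbed_attains_min:
  fixes p :: "real \<Rightarrow> real"
  assumes ne: "u0 \<in> conjugate_domain f"
    and bd: "\<And>u. u \<in> conjugate_domain f \<Longrightarrow> \<bar>u\<bar> \<le> L"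
    and cont: "continuous_on UNIV p"
  obtains u where "u \<in> conjugate_domain f"
    "\<And>u'. u' \<in> conjugate_domain f \<Longrightarrow> real_conjugate f u + p u \<le> real_conjugate f u' + p u'"
proof -
  define r1 where "r1 = real_conjugate f u0 + p u0"
  \<comment> \<open>The epigraph of \<open>real_conjugate f + p\<close>, cut off at its height over
    \<open>u0\<close>. Stating membership as one inequality per \<open>z\<close> makes it an
    intersection of closed sets.\<close>
  define E where "E = {x :: real \<times> real. (\<forall>z. z * fst x - f z + p (fst x) \<le> snd x)
    \<and> \<bar>fst x\<bar> \<le> L \<and> snd x \<le> r1}"
  have epi: "fst x \<in> conjugate_domain f" "real_conjugate f (fst x) + p (fst x) \<le> snd x" if "x \<in> E" for x
  proof -
    have le: "z * fst x - f z \<le> snd x - p (fst x)" for z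
    proof -
      have "z * fst x - f z + p (fst x) \<le> snd x" using that by (auto simp: E_def)
      then show ?thesis by simp
    qed
    show "fst x \<in> conjugate_domain f" using le by (rule conjugate_domainI)
    show "real_conjugate f (fst x) + p (fst x) \<le> snd x"
      using real_conjugate_le[of "fst x" f, OF le] by simp
  qed
  have mem: "(u, real_conjugate f u + p u) \<in> E"
    if "u \<in> conjugate_domain f" "real_conjugate f u + p u \<le> r1" for u
    using that bd real_conjugate_ge[of u f] by (auto simp: E_def)
  have "closed E"
    unfolding E_def
    by (intro closed_Collect_conj closed_Collect_all closed_Collect_le continuous_intros
        continuous_on_compose2[OF cont]) auto
  moreover obtain c where c: "\<And>u. \<bar>u\<bar> \<le> L \<Longrightarrow> c \<le> p u"
  proof (cases "{-L..L} = {}")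
    case True
    then show ?thesis using that[of 0] by force
  next
    case False
    then obtain w where "\<forall>u\<in>{-L..L}. p w \<le> p u"
      using continuous_attains_inf[of "{-L..L}" p] continuous_on_subset[OF cont] by auto
    then show ?thesis using that[of "p w"] by (auto simp: abs_le_iff)
  qed
  have "E \<subseteq> {-L..L} \<times> {- f 0 + c..r1}"
  proof
    fix x assume x: "x \<in> E"
    \<comment> \<open>The inequality for \<open>z = 0\<close> is what bounds the height from
      below.\<close>
    then have "0 * fst x - f 0 + p (fst x) \<le> snd x" "\<bar>fst x\<bar> \<le> L" "snd x \<le> r1"
      unfolding E_def by blast+
    then show "x \<in> {-L..L} \<times> {- f 0 + c..r1}" using c[of "fst x"]
      by (auto simp: mem_Times_iff)
  qed
  then have "bounded E" by (rule bounded_subset[rotated]) (intro bounded_Times bounded_closed_interval)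
  ultimately have "compact E" by (simp add: compact_eq_bounded_closed)
  moreover have "E \<noteq> {}" using mem[OF ne] by (auto simp: r1_def)
  ultimately have "\<exists>x\<in>E. \<forall>y\<in>E. snd x \<le> snd y"
    by (intro continuous_attains_inf continuous_intros)
  then obtain x where x: "x \<in> E" "\<And>y. y \<in> E \<Longrightarrow> snd x \<le> snd y"
    by blast
  show ?thesis
  proof (rule that[of "fst x"])
    fix u' assume u': "u' \<in> conjugate_domain f"
    show "real_conjugate f (fst x) + p (fst x) \<le> real_conjugate f u' + p u'"
    proof (cases "real_conjugate f u' + p u' \<le> r1")
      case True
      then show ?thesis using x(2)[OF mem[OF u']] epi(2)[OF x(1)] by simp
    next
      case False
      then show ?thesis using epi(2)[OF x(1)] x(1) by (simp add: E_def)
    qed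
  qed (use epi x in auto)
qed

section \<open>Duality gap\<close>

lemma inner_primal_of_dual:
  fixes X :: "real^'d^'n"
  shows "primal_of_dual X lam \<alpha> \<bullet> w
    = 1 / (lam * real CARD('n)) * (\<Sum>i\<in>UNIV. \<alpha> $ i * (w \<bullet> row i X))"
proof -
  have "(transpose X *v \<alpha>) \<bullet> w = \<alpha> \<bullet> (X *v w)"
    by (simp add: dot_lmul_matrix flip: vector_transpose_matrix)
  also have "\<dots> = (\<Sum>i\<in>UNIV. \<alpha> $ i * (w \<bullet> row i X))"
    by (simp add: inner_vec_def[of \<alpha>] matrix_vector_mul_component row_def vec_lambda_eta inner_commute)
  finally show ?thesis by (simp add: primal_of_dual_def)
qed

lemma primal_of_dual_linear_combination:
  "primal_of_dual X lam (a *\<^sub>R x + c *\<^sub>R y)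
    = a *\<^sub>R primal_of_dual X lam x + c *\<^sub>R primal_of_dual X lam y"
  by (simp add: primal_of_dual_def matrix_vector_right_distrib matrix_vector_mult_scaleR
      scaleR_add_right mult.commute)

lemma convex_combination_norm_sq_le:
  fixes x y :: "'a :: real_inner"
  assumes "0 \<le> u" "0 \<le> v" "u + v = 1"
  shows "(norm (u *\<^sub>R x + v *\<^sub>R y))\<^sup>2 \<le> u * (norm x)\<^sup>2 + v * (norm y)\<^sup>2"
proof -
  have v: "v = 1 - u" using assms by simp
  have "u * (norm x)\<^sup>2 + v * (norm y)\<^sup>2 - (norm (u *\<^sub>R x + v *\<^sub>R y))\<^sup>2 = u * v * (norm (x - y))\<^sup>2"
    unfolding power2_norm_eq_inner v
    by (simp add: inner_add_left inner_add_right inner_diff_left inner_diff_right inner_commute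
        algebra_simps power2_eq_square)
  moreover have "0 \<le> u * v * (norm (x - y))\<^sup>2" using assms by simp
  ultimately show ?thesis by linarith
qed

locale lipschitz_erm =
  fixes X :: "real^'d^'n"
    and lam L :: real
    and \<phi> :: "'n \<Rightarrow> real \<Rightarrow> real"
  assumes lam_pos: "lam > 0"
    and loss_convex: "\<And>i. convex_on UNIV (\<phi> i)"
    and loss_Lipschitz: "\<And>i a c. \<bar>\<phi> i a - \<phi> i c\<bar> \<le> L * \<bar>a - c\<bar>"
begin

text \<open>The effective domain of the dual objective; \<open>real_dual\<close> and
  \<open>gap\<close> below are faithful only here.\<close>

definition feasible :: "(real^'n) set" where
  "feasible = {\<alpha>. \<forall>i. - (\<alpha> $ i) \<in> conjugate_domain (\<phi> i)}"

definition real_dual :: "real^'n \<Rightarrow> real" where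
  "real_dual \<alpha> = - (1 / real CARD('n) * (\<Sum>i\<in>UNIV. real_conjugate (\<phi> i) (- (\<alpha> $ i))))
     - lam / 2 * (norm (primal_of_dual X lam \<alpha>))\<^sup>2"

definition gap :: "real^'n \<Rightarrow> real" where
  "gap \<alpha> = primal X lam \<phi> (primal_of_dual X lam \<alpha>) - real_dual \<alpha>"

lemma dual_feasible: "\<alpha> \<in> feasible \<Longrightarrow> dual X lam \<phi> \<alpha> = ereal (real_dual \<alpha>)"
  by (simp add: dual_def real_dual_def feasible_def conjugate_eq_real)

lemma dual_infeasible:
  assumes "\<alpha> \<notin> feasible"
  shows "dual X lam \<phi> \<alpha> = - \<infinity>"
proof -
  obtain i where "- (\<alpha> $ i) \<notin> conjugate_domain (\<phi> i)"
    using assms by (auto simp: feasible_def)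
  then have "(\<Sum>i\<in>UNIV. conjugate (\<phi> i) (- (\<alpha> $ i))) = \<infinity>"
    by (auto simp: sum_Pinfty intro: conjugate_eq_infinity)
  then show ?thesis by (simp add: dual_def)
qed

lemma convex_feasible: "convex feasible"
proof -
  have "- (u * (x $ i) + v * (y $ i)) \<in> conjugate_domain (\<phi> i)"
    if "x \<in> feasible" "y \<in> feasible" "0 \<le> u" "0 \<le> v" "u + v = 1" for x y u v i
    using that convexD[OF convex_conjugate_domain[of "\<phi> i"], of "- (x $ i)" "- (y $ i)" u v]
    by (simp add: feasible_def algebra_simps)
  then show ?thesis by (auto simp: convex_def feasible_def)
qed

text \<open>The two quadratic terms add up to \<open>lam\<close> times the squared norm, which by
  adjointness is the average of \<open>\<alpha> $ i\<close> times the i-th prediction. The gap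
  becomes an average of Fenchel-Young slacks, the quantities that the single coordinate steps
  control.\<close>

lemma gap_eq_sum_slack:
  "gap \<alpha> = 1 / real CARD('n) * (\<Sum>i\<in>UNIV. \<phi> i (primal_of_dual X lam \<alpha> \<bullet> row i X)
    + real_conjugate (\<phi> i) (- (\<alpha> $ i)) + \<alpha> $ i * (primal_of_dual X lam \<alpha> \<bullet> row i X))"
proof -
  have "lam * (norm (primal_of_dual X lam \<alpha>))\<^sup>2
    = 1 / real CARD('n) * (\<Sum>i\<in>UNIV. \<alpha> $ i * (primal_of_dual X lam \<alpha> \<bullet> row i X))"
    unfolding power2_norm_eq_inner inner_primal_of_dual using lam_pos by simp
  then show ?thesis
    by (simp add: gap_def primal_def real_dual_def sum.distrib distrib_left)
qed

text \<open>Fenchel-Young for each example, plus the square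
  \<open>lam / 2 * (norm (w - u))\<^sup>2\<close> for the regulariser. The point \<open>w\<close> is
  arbitrary because the dual maximiser is later compared with the primal point of a different dual
  vector.\<close>

lemma weak_duality:
  assumes "\<alpha> \<in> feasible"
  shows "real_dual \<alpha> \<le> primal X lam \<phi> w"
proof -
  define u where "u = primal_of_dual X lam \<alpha>"
  have "- (\<alpha> $ i * (w \<bullet> row i X)) \<le> \<phi> i (w \<bullet> row i X) + real_conjugate (\<phi> i) (- (\<alpha> $ i))" for i
    using real_conjugate_ge[of "- (\<alpha> $ i)" "\<phi> i" "w \<bullet> row i X"] assms
    by (simp add: feasible_def algebra_simps)
  then have "(\<Sum>i\<in>UNIV. - (\<alpha> $ i * (w \<bullet> row i X)))
    \<le> (\<Sum>i\<in>UNIV. \<phi> i (w \<bullet> row i X) + real_conjugate (\<phi> i) (- (\<alpha> $ i)))"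
    by (rule sum_mono)
  then have "1 / real CARD('n) * (\<Sum>i\<in>UNIV. - (\<alpha> $ i * (w \<bullet> row i X)))
    \<le> 1 / real CARD('n) * (\<Sum>i\<in>UNIV. \<phi> i (w \<bullet> row i X) + real_conjugate (\<phi> i) (- (\<alpha> $ i)))"
    by (rule mult_left_mono) simp
  moreover have "1 / real CARD('n) * (\<Sum>i\<in>UNIV. - (\<alpha> $ i * (w \<bullet> row i X))) = - lam * (u \<bullet> w)"
    unfolding u_def inner_primal_of_dual using lam_pos by (simp add: sum_negf)
  moreover have "lam / 2 * (norm (w - u))\<^sup>2 \<ge> 0" using lam_pos by simp
  moreover have "lam / 2 * (norm (w - u))\<^sup>2
      = lam / 2 * (norm w)\<^sup>2 + lam / 2 * (norm u)\<^sup>2 - lam * (u \<bullet> w)"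
    by (simp add: power2_norm_eq_inner inner_diff_left inner_diff_right inner_commute algebra_simps)
  ultimately show ?thesis
    by (simp add: primal_def real_dual_def u_def sum.distrib distrib_left)
qed

text \<open>The slack form hides convexity behind its bilinear term. With that term written back as
  a squared norm, every summand is convex: losses of linear functions, conjugates, and
  \<open>lam\<close> times a squared norm.\<close>

lemma convex_on_gap: "convex_on feasible gap"
proof -
  define g where "g i \<alpha> = \<phi> i (primal_of_dual X lam \<alpha> \<bullet> row i X) + real_conjugate (\<phi> i) (- (\<alpha> $ i))"
    for i \<alpha>
  have gap: "gap \<alpha> = 1 / real CARD('n) * (\<Sum>i\<in>UNIV. g i \<alpha>) + lam * (norm (primal_of_dual X lam \<alpha>))\<^sup>2"
    for \<alpha>
    by (simp add: gap_def primal_def real_dual_def g_def sum.distrib distrib_left)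
  show ?thesis
    unfolding convex_on_def
  proof (intro conjI convex_feasible ballI allI impI)
    fix x y and s t :: real
    assume *: "x \<in> feasible" "y \<in> feasible" "0 \<le> s" "0 \<le> t" "s + t = 1"
    let ?p = "primal_of_dual X lam"
    have "g i (s *\<^sub>R x + t *\<^sub>R y) \<le> s * g i x + t * g i y" for i
    proof -
      have "\<phi> i (?p (s *\<^sub>R x + t *\<^sub>R y) \<bullet> row i X) \<le> s * \<phi> i (?p x \<bullet> row i X) + t * \<phi> i (?p y \<bullet> row i X)"
        using loss_convex[of i] * unfolding convex_on_def
        by (simp add: primal_of_dual_linear_combination inner_add_left)
      moreover have "real_conjugate (\<phi> i) (- ((s *\<^sub>R x + t *\<^sub>R y) $ i))
          \<le> s * real_conjugate (\<phi> i) (- (x $ i)) + t * real_conjugate (\<phi> i) (- (y $ i))"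
      proof -
        have "- ((s *\<^sub>R x + t *\<^sub>R y) $ i) = s *\<^sub>R (- (x $ i)) + t *\<^sub>R (- (y $ i))" by simp
        then show ?thesis
          using convex_on_real_conjugate[of "\<phi> i"] * unfolding convex_on_def feasible_def
          by (metis (mono_tags, lifting) mem_Collect_eq)
      qed
      ultimately show ?thesis by (simp add: g_def distrib_left)
    qed
    then have "(\<Sum>i\<in>UNIV. g i (s *\<^sub>R x + t *\<^sub>R y)) \<le> (\<Sum>i\<in>UNIV. s * g i x + t * g i y)"
      by (rule sum_mono)
    then have "1 / real CARD('n) * (\<Sum>i\<in>UNIV. g i (s *\<^sub>R x + t *\<^sub>R y))
        \<le> 1 / real CARD('n) * (\<Sum>i\<in>UNIV. s * g i x + t * g i y)"
      by (rule mult_left_mono) simp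
    moreover have "lam * (norm (?p (s *\<^sub>R x + t *\<^sub>R y)))\<^sup>2
        \<le> lam * (s * (norm (?p x))\<^sup>2 + t * (norm (?p y))\<^sup>2)"
      unfolding primal_of_dual_linear_combination
      using * lam_pos by (intro mult_left_mono convex_combination_norm_sq_le) auto
    ultimately show "gap (s *\<^sub>R x + t *\<^sub>R y) \<le> s * gap x + t * gap y"
      unfolding gap by (simp add: sum.distrib distrib_left mult.left_commute flip: sum_distrib_left)
  qed
qed

end

section \<open>Expected progress of one mini-batch step\<close>

locale minibatch_sdca = lipschitz_erm X lam L \<phi>
  for X :: "real^'d^'n"
    and lam L :: real
    and \<phi> :: "'n \<Rightarrow> real \<Rightarrow> real" +
  fixes v :: "real^'n"
    and q :: "'n set pmf"
  assumes sampling_uniform: "uniform_sampling q"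
    and batch_pos: "batch_size q > 0"
    and v_pos: "\<And>i. v $ i > 0"
    and eso: "ESO X lam q v"
begin

definition inclusion_prob :: real where
  "inclusion_prob = batch_size q / real CARD('n)"

text \<open>The constant \<open>G\<close> of the theorem.\<close>

definition slack_const :: real where
  "slack_const = 4 * L\<^sup>2 * ((\<Sum>i\<in>UNIV. v $ i) / real CARD('n))"

definition sdca_step :: "real^'n \<Rightarrow> 'n set \<Rightarrow> real^'n" where
  "sdca_step \<alpha> A = (\<chi> i. if i \<in> A then \<alpha> $ i + coord_step X lam \<phi> v \<alpha> i else \<alpha> $ i)"

lemma integrable_sampling [simp]: "integrable (measure_pmf q) (f :: 'n set \<Rightarrow> real)"
  by (rule integrable_measure_pmf_finite) simp

text \<open>The expected size is the sum of the marginals, which are all equal.\<close>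

lemma prob_inclusion: "measure_pmf.prob q {A. i \<in> A} = inclusion_prob"
proof -
  have "batch_size q = measure_pmf.expectation q (\<lambda>A. \<Sum>j\<in>UNIV. indicator {A. j \<in> A} A)"
    unfolding batch_size_def by (simp add: indicator_def sum.If_cases)
  also have "\<dots> = (\<Sum>j\<in>UNIV. measure_pmf.prob q {A. j \<in> A})"
    by (subst Bochner_Integration.integral_sum) simp_all
  also have "\<dots> = (\<Sum>j\<in>(UNIV :: 'n set). measure_pmf.prob q {A. i \<in> A})"
    using sampling_uniform by (intro sum.cong) (auto simp: uniform_sampling_def)
  finally show ?thesis by (simp add: inclusion_prob_def)
qed

lemma inclusion_prob_pos: "0 < inclusion_prob"
  using batch_pos by (simp add: inclusion_prob_def)

lemma inclusion_prob_le_1: "inclusion_prob \<le> 1"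
  using measure_pmf.prob_le_1[of q "{A. undefined \<in> A}"] unfolding prob_inclusion .

lemma expectation_sum_if_sampled:
  "measure_pmf.expectation q (\<lambda>A. \<Sum>i\<in>UNIV. if i \<in> A then f i else g i)
    = (\<Sum>i\<in>UNIV. g i + inclusion_prob * (f i - g i))"
proof -
  have "(\<lambda>A. \<Sum>i\<in>UNIV. if i \<in> A then f i else g i)
      = (\<lambda>A. \<Sum>i\<in>UNIV. g i + indicator {A. i \<in> A} A * (f i - g i))"
    by (intro ext sum.cong) auto
  then show ?thesis
    by (simp add: prob_inclusion measure_pmf.prob_space)
qed

text \<open>\<open>h\<close> is the negated coordinate objective on its effective domain. The claims
  rest on a maximiser existing, as otherwise \<open>coord_step\<close> would be an arbitrary number;
  the first one keeps the iterates feasible.\<close>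

lemma coord_step_minimizes:
  fixes \<alpha> i
  defines "\<delta> \<equiv> coord_step X lam \<phi> v \<alpha> i"
    and "h \<equiv> \<lambda>\<delta>. real_conjugate (\<phi> i) (- (\<alpha> $ i) - \<delta>)
      + (1 / (2 * lam * real CARD('n)) * v $ i * \<delta>\<^sup>2 + (primal_of_dual X lam \<alpha> \<bullet> row i X) * \<delta>)"
  assumes \<alpha>: "\<alpha> \<in> feasible"
  shows "- (\<alpha> $ i) - \<delta> \<in> conjugate_domain (\<phi> i)"
    and "\<And>\<delta>'. - (\<alpha> $ i) - \<delta>' \<in> conjugate_domain (\<phi> i) \<Longrightarrow> h \<delta> \<le> h \<delta>'"
proof -
  let ?D = "conjugate_domain (\<phi> i)" and ?a = "- (\<alpha> $ i)"
  let ?obj = "coord_objective X lam \<phi> v \<alpha> i"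
  have obj: "?obj x = ereal (- h x)" if "?a - x \<in> ?D" for x
    using that by (simp add: coord_objective_def conjugate_eq_real h_def)
  have obj': "?obj x = - \<infinity>" if "?a - x \<notin> ?D" for x
    using that by (simp add: coord_objective_def conjugate_eq_infinity)
  \<comment> \<open>The smooth part of \<open>h\<close> after the substitution
    \<open>u = - (\<alpha> $ i) - \<delta>\<close>, so that the conjugate is evaluated at the
    variable itself.\<close>
  define p where "p u = 1 / (2 * lam * real CARD('n)) * v $ i * (?a - u)\<^sup>2
    + (primal_of_dual X lam \<alpha> \<bullet> row i X) * (?a - u)" for u
  have "continuous_on UNIV p" unfolding p_def by (intro continuous_intros)
  then obtain u where u: "u \<in> ?D"
    "\<And>u'. u' \<in> ?D \<Longrightarrow> real_conjugate (\<phi> i) u + p u \<le> real_conjugate (\<phi> i) u' + p u'"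
    using real_conjugate_perturbed_attains_min[of ?a "\<phi> i" L p]
      abs_le_Lipschitz_if_conjugate_domain[of _ "\<phi> i" L] loss_Lipschitz \<alpha>
    by (auto simp: feasible_def)
  have h: "h x = real_conjugate (\<phi> i) (?a - x) + p (?a - x)" for x
    by (simp add: h_def p_def)
  have "h (?a - u) \<le> h x" if "?a - x \<in> ?D" for x
    using u(2)[OF that] by (simp add: h)
  then have "?obj x \<le> ?obj (?a - u)" for x
    by (cases "?a - x \<in> ?D") (use u(1) in \<open>simp_all add: obj obj'\<close>)
  then have "is_arg_max ?obj (\<lambda>_. True) (?a - u)"
    by (simp add: is_arg_max_def not_less)
  then have "is_arg_max ?obj (\<lambda>_. True) \<delta>"
    unfolding \<delta>_def coord_step_def arg_max_def by (rule someI)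
  then have max: "?obj x \<le> ?obj \<delta>" for x
    by (simp add: is_arg_max_def not_less)
  show D: "?a - \<delta> \<in> ?D"
  proof (rule ccontr)
    assume "?a - \<delta> \<notin> ?D"
    then show False using max[of "?a - u"] u(1) by (simp add: obj obj')
  qed
  show "h \<delta> \<le> h \<delta>'" if "?a - \<delta>' \<in> ?D" for \<delta>'
    using max[of \<delta>'] that D by (simp add: obj)
qed

lemma feasible_sdca_step:
  assumes "\<alpha> \<in> feasible"
  shows "sdca_step \<alpha> A \<in> feasible"
  using assms coord_step_minimizes(1)[OF assms] by (auto simp: feasible_def sdca_step_def)

text \<open>
  The exact maximiser is compared with the point at fraction \<open>s\<close> of the way from \<open>\<alpha> $ i\<close> to the
  negative of a subgradient of \<open>\<phi> i\<close> at the current prediction.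
\<close>

lemma coord_step_gain:
  fixes \<alpha> i
  defines "\<delta> \<equiv> coord_step X lam \<phi> v \<alpha> i" and "m \<equiv> primal_of_dual X lam \<alpha> \<bullet> row i X"
  assumes \<alpha>: "\<alpha> \<in> feasible" and s: "0 \<le> s" "s \<le> 1"
  shows "s * (\<phi> i m + real_conjugate (\<phi> i) (- (\<alpha> $ i)) + \<alpha> $ i * m)
      - s\<^sup>2 / (2 * lam * real CARD('n)) * (4 * L\<^sup>2 * v $ i)
    \<le> real_conjugate (\<phi> i) (- (\<alpha> $ i)) - real_conjugate (\<phi> i) (- (\<alpha> $ i) - \<delta>)
      - 1 / (2 * lam * real CARD('n)) * v $ i * \<delta>\<^sup>2 - m * \<delta>"
proof -
  let ?R = "real_conjugate (\<phi> i)" and ?a = "- (\<alpha> $ i)"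
  let ?c = "1 / (2 * lam * real CARD('n)) * v $ i"
  obtain u where u: "u \<in> conjugate_domain (\<phi> i)" "?R u = m * u - \<phi> i m"
    using real_conjugate_subgradient[OF loss_convex] by metis
  define \<delta>' where "\<delta>' = s * (?a - u)"
  have a: "?a \<in> conjugate_domain (\<phi> i)" using \<alpha> by (simp add: feasible_def)
  have c: "?c \<ge> 0" using lam_pos v_pos[of i] by simp
  have eq: "?a - \<delta>' = (1 - s) *\<^sub>R ?a + s *\<^sub>R u" by (simp add: \<delta>'_def algebra_simps)
  have dom: "?a - \<delta>' \<in> conjugate_domain (\<phi> i)"
    unfolding eq using s a u by (intro convexD[OF convex_conjugate_domain]) auto
  have R: "?R (?a - \<delta>') \<le> (1 - s) * ?R ?a + s * ?R u"
    unfolding eq using s a u by (intro convex_onD[OF convex_on_real_conjugate]) auto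
  \<comment> \<open>Both points lie in [-L, L]; squaring gives the 4 L^2 of
    \<open>slack_const\<close>.\<close>
  have "\<bar>?a - u\<bar> \<le> 2 * L"
    using abs_le_Lipschitz_if_conjugate_domain[OF a, of L]
      abs_le_Lipschitz_if_conjugate_domain[OF u(1), of L] loss_Lipschitz by force
  then have "(?a - u)\<^sup>2 \<le> (2 * L)\<^sup>2"
    by (metis abs_ge_zero power2_abs power_mono)
  then have "?c * \<delta>'\<^sup>2 \<le> ?c * (s\<^sup>2 * (2 * L)\<^sup>2)"
    unfolding \<delta>'_def power_mult_distrib[of s] by (intro mult_left_mono c) auto
  moreover have "?R (?a - \<delta>) + (?c * \<delta>\<^sup>2 + m * \<delta>) \<le> ?R (?a - \<delta>') + (?c * \<delta>'\<^sup>2 + m * \<delta>')"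
    using coord_step_minimizes(2)[OF \<alpha> dom] by (simp add: \<delta>_def m_def)
  moreover have "?c * (s\<^sup>2 * (2 * L)\<^sup>2) = s\<^sup>2 / (2 * lam * real CARD('n)) * (4 * L\<^sup>2 * v $ i)"
    by (simp add: power_mult_distrib)
  \<comment> \<open>The Fenchel-Young equality for \<open>u\<close> makes all terms in
    \<open>u\<close> cancel and leaves \<open>s\<close> times the slack at
    \<open>\<alpha>\<close>.\<close>
  moreover have "?R ?a - ((1 - s) * ?R ?a + s * ?R u) - m * \<delta>' = s * (\<phi> i m + ?R ?a + \<alpha> $ i * m)"
    unfolding u(2) \<delta>'_def by (simp add: algebra_simps)
  ultimately show ?thesis using R by linarith
qed

text \<open>The conjugate part is separable, so its expected change is \<open>inclusion_prob\<close>
  times the full change. The squared norm couples the coordinates; ESO bounds it by a separable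
  expression whose summands are the penalties of the coordinate problems, so simultaneous updates
  can be charged coordinate by coordinate.\<close>

lemma expected_progress:
  assumes \<alpha>: "\<alpha> \<in> feasible" and s: "0 \<le> s" "s \<le> 1"
  shows "real_dual \<alpha> + inclusion_prob * (s * gap \<alpha> - s\<^sup>2 * slack_const / (2 * lam * real CARD('n)))
    \<le> measure_pmf.expectation q (\<lambda>A. real_dual (sdca_step \<alpha> A))"
proof -
  let ?n = "real CARD('n)" and ?p = "inclusion_prob" and ?w = "primal_of_dual X lam \<alpha>"
  define \<delta> where "\<delta> = (\<chi> i. coord_step X lam \<phi> v \<alpha> i)"
  define R where "R i = real_conjugate (\<phi> i) (- (\<alpha> $ i))" for i
  define R' where "R' i = real_conjugate (\<phi> i) (- (\<alpha> $ i) - \<delta> $ i)" for i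
  define m where "m i = ?w \<bullet> row i X" for i
  have step: "sdca_step \<alpha> A = \<alpha> + vrestrict \<delta> A" for A
    by (simp add: sdca_step_def vrestrict_def \<delta>_def vec_eq_iff)
  have dual_step: "real_dual (sdca_step \<alpha> A) = - (1 / ?n * (\<Sum>i\<in>UNIV. if i \<in> A then R' i else R i))
      - lam / 2 * (norm (primal_of_dual X lam (\<alpha> + vrestrict \<delta> A)))\<^sup>2" for A
  proof -
    have "real_conjugate (\<phi> i) (- ((\<alpha> + vrestrict \<delta> A) $ i)) = (if i \<in> A then R' i else R i)" for i
      by (simp add: R_def R'_def vrestrict_def)
    then show ?thesis unfolding real_dual_def step by simp
  qed
  define E where "E = measure_pmf.expectation q (\<lambda>A. (norm (primal_of_dual X lam (\<alpha> + vrestrict \<delta> A)))\<^sup>2)"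
  have exp: "measure_pmf.expectation q (\<lambda>A. real_dual (sdca_step \<alpha> A))
      = - (1 / ?n * (\<Sum>i\<in>UNIV. R i + ?p * (R' i - R i))) - lam / 2 * E"
    unfolding dual_step E_def expectation_sum_if_sampled[symmetric] by simp
  have "E \<le> (norm ?w)\<^sup>2 + ?p * (weighted_sqnorm v ((1 / (lam * ?n)) *\<^sub>R \<delta>)
             + 2 / (lam * ?n) * (\<delta> \<bullet> (X *v ?w)))"
    using eso unfolding ESO_def E_def inclusion_prob_def by blast
  then have "lam / 2 * E \<le> lam / 2 * ((norm ?w)\<^sup>2 + ?p * (weighted_sqnorm v ((1 / (lam * ?n)) *\<^sub>R \<delta>)
             + 2 / (lam * ?n) * (\<delta> \<bullet> (X *v ?w))))"
    using lam_pos by (intro mult_left_mono) auto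
  also have "\<dots> = lam / 2 * (norm ?w)\<^sup>2 + ?p * (lam / 2 * weighted_sqnorm v ((1 / (lam * ?n)) *\<^sub>R \<delta>)
             + 1 / ?n * (\<delta> \<bullet> (X *v ?w)))"
    using lam_pos by (simp add: field_simps)
  \<comment> \<open>The scaling in ESO reproduces the quadratic penalty of
    \<open>coord_objective\<close>.\<close>
  also have "lam / 2 * weighted_sqnorm v ((1 / (lam * ?n)) *\<^sub>R \<delta>)
      = 1 / ?n * (\<Sum>i\<in>UNIV. 1 / (2 * lam * ?n) * v $ i * (\<delta> $ i)\<^sup>2)"
    using lam_pos by (simp add: weighted_sqnorm_def sum_distrib_left power2_eq_square field_simps)
  also have "\<delta> \<bullet> (X *v ?w) = (\<Sum>i\<in>UNIV. m i * \<delta> $ i)"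
    by (simp add: inner_vec_def[of \<delta>] matrix_vector_mul_component row_def vec_lambda_eta inner_commute
        m_def mult.commute)
  finally have E: "lam / 2 * E \<le> lam / 2 * (norm ?w)\<^sup>2 + ?p * (1 / ?n
      * (\<Sum>i\<in>UNIV. 1 / (2 * lam * ?n) * v $ i * (\<delta> $ i)\<^sup>2 + m i * \<delta> $ i))"
    by (simp add: sum.distrib distrib_left)
  have "(\<Sum>i\<in>UNIV. s * (\<phi> i (m i) + R i + \<alpha> $ i * m i) - s\<^sup>2 / (2 * lam * ?n) * (4 * L\<^sup>2 * v $ i))
      \<le> (\<Sum>i\<in>UNIV. R i - R' i - 1 / (2 * lam * ?n) * v $ i * (\<delta> $ i)\<^sup>2 - m i * \<delta> $ i)"
    using coord_step_gain[OF \<alpha> s] unfolding R_def R'_def m_def \<delta>_def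
    by (intro sum_mono) simp
  then have "?p * (1 / ?n * (\<Sum>i\<in>UNIV. s * (\<phi> i (m i) + R i + \<alpha> $ i * m i) - s\<^sup>2 / (2 * lam * ?n) * (4 * L\<^sup>2 * v $ i)))
      \<le> ?p * (1 / ?n * (\<Sum>i\<in>UNIV. R i - R' i - 1 / (2 * lam * ?n) * v $ i * (\<delta> $ i)\<^sup>2 - m i * \<delta> $ i))"
    using inclusion_prob_pos by (intro mult_left_mono) auto
  moreover have slack: "1 / ?n * (\<Sum>i\<in>UNIV. s * (\<phi> i (m i) + R i + \<alpha> $ i * m i) - s\<^sup>2 / (2 * lam * ?n) * (4 * L\<^sup>2 * v $ i))
      = s * gap \<alpha> - s\<^sup>2 * slack_const / (2 * lam * ?n)"
    unfolding gap_eq_sum_slack slack_const_def sum_subtractf sum_distrib_left[symmetric]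
    by (simp add: R_def m_def field_simps)
  moreover have "?p * (1 / ?n * (\<Sum>i\<in>UNIV. R i - R' i - 1 / (2 * lam * ?n) * v $ i * (\<delta> $ i)\<^sup>2 - m i * \<delta> $ i))
      = - (1 / ?n * (\<Sum>i\<in>UNIV. R i + ?p * (R' i - R i))) + 1 / ?n * (\<Sum>i\<in>UNIV. R i)
        - ?p * (1 / ?n * (\<Sum>i\<in>UNIV. 1 / (2 * lam * ?n) * v $ i * (\<delta> $ i)\<^sup>2 + m i * \<delta> $ i))"
  proof -
    have "(\<Sum>i\<in>UNIV. R i + ?p * (R' i - R i)) = sum R UNIV + ?p * (sum R' UNIV - sum R UNIV)"
      unfolding sum.distrib sum_distrib_left[symmetric] sum_subtractf ..
    moreover have "(\<Sum>i\<in>UNIV. R i - R' i - 1 / (2 * lam * ?n) * v $ i * (\<delta> $ i)\<^sup>2 - m i * \<delta> $ i)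
        = sum R UNIV - sum R' UNIV - (\<Sum>i\<in>UNIV. 1 / (2 * lam * ?n) * v $ i * (\<delta> $ i)\<^sup>2 + m i * \<delta> $ i)"
      unfolding sum.distrib sum_subtractf by simp
    ultimately show ?thesis by (simp only:) (simp add: algebra_simps)
  qed
  moreover have "real_dual \<alpha> = - (1 / ?n * (\<Sum>i\<in>UNIV. R i)) - lam / 2 * (norm ?w)\<^sup>2"
    by (simp add: real_dual_def R_def)
  ultimately show ?thesis
    using E unfolding exp slack by linarith
qed

end

section \<open>Functions of a finite sampling history\<close>

lemma ereal_expectation_eq_integral:
  assumes int: "integrable M g"
  shows "ereal_expectation M (\<lambda>\<omega>. ereal (g \<omega>)) = ereal (\<integral>\<omega>. g \<omega> \<partial>M)"
proof -
  have "(\<integral>\<^sup>+\<omega>. ennreal (g \<omega>) \<partial>M) \<noteq> \<infinity>" "(\<integral>\<^sup>+\<omega>. ennreal (- g \<omega>) \<partial>M) \<noteq> \<infinity>"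
    using int by (auto simp: real_integrable_def)
  then obtain r s where r: "(\<integral>\<^sup>+\<omega>. ennreal (g \<omega>) \<partial>M) = ennreal r" "0 \<le> r"
    and s: "(\<integral>\<^sup>+\<omega>. ennreal (- g \<omega>) \<partial>M) = ennreal s" "0 \<le> s"
    by (metis ennreal_cases infinity_ennreal_def)
  then show ?thesis
    by (simp add: ereal_expectation_def real_lebesgue_integral_def[OF int] e2ennreal_ereal)
qed

text \<open>Stands in for adaptedness to a filtration. The result type is free, so that
  \<open>F\<close> may also return a function of the next batch.\<close>

definition depends_below :: "nat \<Rightarrow> ((nat \<Rightarrow> 'a) \<Rightarrow> 'b) \<Rightarrow> bool" where
  "depends_below t F \<longleftrightarrow> (\<forall>s s'. (\<forall>k<t. s k = s' k) \<longrightarrow> F s = F s')"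

lemma depends_below_comp: "depends_below t F \<Longrightarrow> depends_below t (\<lambda>s. h (F s))"
  unfolding depends_below_def by metis

text \<open>Iterate \<open>t\<close> has used only the batches before index \<open>t\<close>, so
  batch \<open>t\<close> is still fresh.\<close>

lemma depends_below_sdca:
  fixes X :: "real^'d^'n"
  shows "depends_below t (\<lambda>s. sdca X lam \<phi> v s t)"
proof (induction t)
  case (Suc t)
  show ?case
    unfolding depends_below_def
  proof (intro allI impI)
    fix s s' :: "nat \<Rightarrow> 'n set"
    assume *: "\<forall>k<Suc t. s k = s' k"
    then have "sdca X lam \<phi> v s t = sdca X lam \<phi> v s' t"
      using Suc.IH unfolding depends_below_def by (metis less_SucI)
    then show "sdca X lam \<phi> v s (Suc t) = sdca X lam \<phi> v s' (Suc t)"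
      using * by (simp cong: if_cong)
  qed
qed (simp add: depends_below_def)

locale iid_sampling = prob_space M
  for M :: "'w measure" +
  fixes S :: "nat \<Rightarrow> 'w \<Rightarrow> 'k :: finite"
    and q :: "'k pmf"
  assumes S_indep: "indep_vars (\<lambda>_. count_space UNIV) S UNIV"
    and S_distr: "\<And>t. distr M (count_space UNIV) (S t) = measure_pmf q"
begin

lemma measurable_S [measurable]: "S t \<in> measurable M (count_space UNIV)"
  using S_indep by (auto simp: indep_vars_def)

lemma PiM_history:
  "PiM {..<t :: nat} (\<lambda>_. count_space (UNIV :: 'k set)) = count_space ({..<t} \<rightarrow>\<^sub>E UNIV)"
  by (rule count_space_PiM_finite) auto

lemma depends_below_restrict:
  "depends_below t F \<Longrightarrow> F (\<lambda>k. S k \<omega>) = F (restrict (\<lambda>k. S k \<omega>) {..<t})"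
  unfolding depends_below_def by auto

text \<open>The product sigma-algebra on finite histories over a finite type is discrete, so every
  function of the history is measurable.\<close>

lemma measurable_history:
  assumes "depends_below t F"
  shows "(\<lambda>\<omega>. F (\<lambda>k. S k \<omega>)) \<in> measurable M (count_space UNIV)"
proof -
  have "(\<lambda>\<omega>. restrict (\<lambda>k. S k \<omega>) {..<t}) \<in> measurable M (count_space ({..<t} \<rightarrow>\<^sub>E UNIV))"
    unfolding PiM_history[symmetric] by (intro measurable_restrict measurable_S)
  then have "(\<lambda>\<omega>. F (restrict (\<lambda>k. S k \<omega>) {..<t})) \<in> measurable M (count_space UNIV)"
    by (rule measurable_compose) simp
  then show ?thesis by (simp add: depends_below_restrict[OF assms])
qed

lemma integrable_history:
  fixes F :: "(nat \<Rightarrow> 'k) \<Rightarrow> real"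
  assumes "depends_below t F"
  shows "integrable M (\<lambda>\<omega>. F (\<lambda>k. S k \<omega>))"
proof (rule integrable_const_bound)
  let ?H = "{..<t} \<rightarrow>\<^sub>E (UNIV :: 'k set)"
  have "finite ?H" by (intro finite_PiE) auto
  then have "\<bar>F (restrict (\<lambda>k. S k \<omega>) {..<t})\<bar> \<le> Max ((\<lambda>h. \<bar>F h\<bar>) ` ?H)" for \<omega>
    by (intro Max_ge) auto
  then show "AE \<omega> in M. norm (F (\<lambda>k. S k \<omega>)) \<le> Max ((\<lambda>h. \<bar>F h\<bar>) ` ?H)"
    by (simp add: depends_below_restrict[OF assms])
  show "(\<lambda>\<omega>. F (\<lambda>k. S k \<omega>)) \<in> borel_measurable M"
    using measurable_history[OF assms] by (rule measurable_compose) simp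
qed

lemma prob_S: "prob (S t -` {A} \<inter> space M) = pmf q A"
  by (simp add: pmf.rep_eq flip: S_distr[of t] measure_distr[OF measurable_S, of "{A}"])

lemma indep_history:
  fixes F :: "(nat \<Rightarrow> 'k) \<Rightarrow> real"
  assumes "depends_below t F"
  shows "indep_var borel (\<lambda>\<omega>. F (\<lambda>k. S k \<omega>)) borel (\<lambda>\<omega>. indicator {A} (S t \<omega>) :: real)"
proof -
  have "indep_var (PiM {..<t} (\<lambda>_. count_space UNIV)) (\<lambda>\<omega>. restrict (\<lambda>k. S k \<omega>) {..<t})
      (PiM {t} (\<lambda>_. count_space UNIV)) (\<lambda>\<omega>. restrict (\<lambda>k. S k \<omega>) {t})"
    by (rule indep_var_restrict[OF S_indep]) auto
  then have "indep_var borel (F \<circ> (\<lambda>\<omega>. restrict (\<lambda>k. S k \<omega>) {..<t}))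
      borel ((\<lambda>h. indicator {A} (h t)) \<circ> (\<lambda>\<omega>. restrict (\<lambda>k. S k \<omega>) {t}))"
  proof (rule indep_var_compose)
    show "F \<in> borel_measurable (PiM {..<t} (\<lambda>_. count_space UNIV))"
      unfolding PiM_history by simp
    show "(\<lambda>h. indicator {A} (h t) :: real) \<in> borel_measurable (PiM {t} (\<lambda>_. count_space UNIV))"
      by (rule measurable_compose[OF measurable_component_singleton]) auto
  qed
  then show ?thesis
    by (simp add: comp_def flip: depends_below_restrict[OF assms])
qed

text \<open>The tower property without conditional expectations: split over the finitely many values
  of \<open>S t\<close> and factor each term by independence from the history.\<close>

lemma expectation_next_sample:
  fixes g :: "(nat \<Rightarrow> 'k) \<Rightarrow> 'k \<Rightarrow> real"
  assumes g: "depends_below t g"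
  shows "expectation (\<lambda>\<omega>. g (\<lambda>k. S k \<omega>) (S t \<omega>))
    = expectation (\<lambda>\<omega>. measure_pmf.expectation q (g (\<lambda>k. S k \<omega>)))"
proof -
  have gA: "depends_below t (\<lambda>s. g s A)" for A
    using depends_below_comp[OF g, of "\<lambda>f. f A"] .
  have ind: "integrable M (\<lambda>\<omega>. indicator {A} (S t \<omega>) :: real)" for A
    by (rule integrable_history[of "Suc t" "\<lambda>s. indicator {A} (s t)"]) (auto simp: depends_below_def)
  have "expectation (\<lambda>\<omega>. indicator {A} (S t \<omega>)) = pmf q A" for A
  proof -
    have "expectation (\<lambda>\<omega>. indicator {A} (S t \<omega>))
        = expectation (indicator (S t -` {A} \<inter> space M))"
      by (intro Bochner_Integration.integral_cong) (auto simp: indicator_def)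
    also have "\<dots> = prob (S t -` {A} \<inter> space M)"
      by (subst Bochner_Integration.integral_indicator) (simp add: Int_assoc)
    finally show ?thesis unfolding prob_S .
  qed
  then have A: "expectation (\<lambda>\<omega>. g (\<lambda>k. S k \<omega>) A * indicator {A} (S t \<omega>))
      = expectation (\<lambda>\<omega>. g (\<lambda>k. S k \<omega>) A) * pmf q A" for A
    by (subst indep_var_lebesgue_integral[OF indep_history[OF gA] integrable_history[OF gA] ind]) simp
  have "expectation (\<lambda>\<omega>. g (\<lambda>k. S k \<omega>) (S t \<omega>))
      = expectation (\<lambda>\<omega>. \<Sum>A\<in>UNIV. g (\<lambda>k. S k \<omega>) A * indicator {A} (S t \<omega>))"
    by (simp add: indicator_def)
  also have "\<dots> = (\<Sum>A\<in>UNIV. expectation (\<lambda>\<omega>. g (\<lambda>k. S k \<omega>) A) * pmf q A)"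
    by (subst Bochner_Integration.integral_sum) (simp_all add: A
      indep_var_integrable[OF indep_history[OF gA] integrable_history[OF gA] ind])
  also have "\<dots> = expectation (\<lambda>\<omega>. \<Sum>A\<in>UNIV. g (\<lambda>k. S k \<omega>) A * pmf q A)"
    by (subst Bochner_Integration.integral_sum) (auto intro: integrable_history gA)
  also have "\<dots> = expectation (\<lambda>\<omega>. measure_pmf.expectation q (g (\<lambda>k. S k \<omega>)))"
    by (subst integral_measure_pmf_real[of UNIV]) (auto simp: mult.commute)
  finally show ?thesis .
qed

end

section \<open>Convergence rate of the recursion\<close>

text \<open>A deterministic recursion for the expected dual suboptimality \<open>e\<close>. As it
  holds for all admissible \<open>s\<close>, the fraction may change from step to step.\<close>

locale sdca_rate =
  fixes e :: "nat \<Rightarrow> real" and n b G lam :: real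
  assumes rec: "\<And>t s. 0 \<le> s \<Longrightarrow> s \<le> 1 \<Longrightarrow>
      e (Suc t) \<le> (1 - s * (b / n)) * e t + b / n * (s\<^sup>2 * G / (2 * lam * n))"
    and b_pos: "0 < b" and b_le_n: "b \<le> n" and lam_pos: "0 < lam" and G_pos: "0 < G"
    and e0_nonneg: "0 \<le> e 0"
begin

lemma n_pos: "0 < n"
  using b_pos b_le_n by linarith

text \<open>\<open>G / (2 * lam * n)\<close> is the fixed point of the recursion for
  \<open>s = 1\<close>; the distance above it contracts by \<open>1 - b / n\<close>.\<close>

lemma linear_rate: "e t \<le> (1 - b / n) ^ t * e 0 + G / (2 * lam * n)"
proof (induction t)
  case 0
  then show ?case using lam_pos G_pos n_pos by simp
next
  case (Suc t)
  have "e (Suc t) \<le> (1 - b / n) * e t + b / n * (G / (2 * lam * n))"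
    using rec[of 1 t] by simp
  also have "\<dots> \<le> (1 - b / n) * ((1 - b / n) ^ t * e 0 + G / (2 * lam * n)) + b / n * (G / (2 * lam * n))"
    using Suc b_le_n n_pos by (intro add_right_mono mult_left_mono) auto
  also have "\<dots> = (1 - b / n) ^ Suc t * e 0 + G / (2 * lam * n)"
    using n_pos lam_pos by (simp add: field_simps)
  finally show ?case .
qed

text \<open>Half of the bound is the fixed point of the linear phase, the other half the transient,
  estimated by \<open>1 - x \<le> exp (- x)\<close>. The guard on \<open>e 0\<close> covers the
  reading of the logarithm as minus infinity.\<close>

lemma burn_in:
  assumes "e 0 \<noteq> 0 \<Longrightarrow> int t0 \<ge> max 0 \<lceil>n / b * ln (2 * lam * n * e 0 / G)\<rceil>"
  shows "e t0 \<le> G / (lam * n)"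
proof -
  have "(1 - b / n) ^ t0 * e 0 \<le> G / (2 * lam * n)"
  proof (cases "e 0 = 0")
    case True
    then show ?thesis using lam_pos G_pos n_pos by simp
  next
    case False
    then have e0: "0 < e 0" using e0_nonneg by simp
    define r where "r = 2 * lam * n * e 0 / G"
    have r: "0 < r" using e0 lam_pos G_pos n_pos by (simp add: r_def)
    have "n / b * ln r \<le> real t0"
      using assms[OF False] unfolding r_def by linarith
    then have "ln r \<le> b / n * real t0"
      using b_pos n_pos by (simp add: field_simps)
    then have "r \<le> exp (b / n * real t0)"
      using r by (metis exp_le_cancel_iff exp_ln)
    then have "exp (- (b / n * real t0)) \<le> 1 / r"
      using r by (simp add: exp_minus inverse_eq_divide frac_le)
    moreover have "(1 - b / n) ^ t0 \<le> exp (- (b / n)) ^ t0"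
      using b_le_n n_pos exp_ge_add_one_self[of "- (b / n)"] by (intro power_mono) auto
    moreover have "exp (- (b / n)) ^ t0 = exp (- (b / n * real t0))"
      by (simp add: exp_of_nat_mult[symmetric] mult.commute)
    ultimately have "(1 - b / n) ^ t0 * e 0 \<le> 1 / r * e 0"
      using e0 by (intro mult_right_mono) auto
    also have "\<dots> = G / (2 * lam * n)" using e0 by (simp add: r_def)
    finally show ?thesis .
  qed
  then show ?thesis using linear_rate[of t0] by (simp add: field_simps)
qed

lemma sublinear_rate:
  assumes t0: "e t0 \<le> G / (lam * n)"
  shows "e (t0 + k) \<le> 2 * G / (lam * (2 * n + b * real k))"
proof (induction k)
  case 0
  then show ?case using t0 by simp
next
  case (Suc k)
  define D where "D = 2 * n + b * real k"
  have D: "D \<ge> 2 * n" "D > 0" using b_pos n_pos by (auto simp: D_def add_pos_nonneg)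
  \<comment> \<open>Minimises the right-hand side of the recursion once \<open>e (t0 + k)\<close> is
    replaced by its bound; \<open>D \<ge> 2 * n\<close> makes it admissible.\<close>
  define s where "s = 2 * n / D"
  have s: "0 \<le> s" "s \<le> 1" using D n_pos by (auto simp: s_def)
  have sb: "s * (b / n) = 2 * b / D" using n_pos by (simp add: s_def)
  \<comment> \<open>Keeps the coefficient of \<open>e (t0 + k)\<close> non-negative, so the
    induction hypothesis can be inserted.\<close>
  have sb1: "s * (b / n) \<le> 1" unfolding sb using D b_le_n by simp
  have "e (Suc (t0 + k)) \<le> (1 - s * (b / n)) * e (t0 + k) + b / n * (s\<^sup>2 * G / (2 * lam * n))"
    by (rule rec[OF s])
  also have "\<dots> \<le> (1 - s * (b / n)) * (2 * G / (lam * D)) + b / n * (s\<^sup>2 * G / (2 * lam * n))"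
    using Suc sb1 unfolding D_def[symmetric]
    by (intro add_right_mono mult_left_mono) auto
  also have "\<dots> = 2 * G / lam * ((D - b) / D\<^sup>2)"
    using D n_pos lam_pos unfolding sb unfolding s_def
    by (simp add: field_simps power2_eq_square)
  also have "\<dots> \<le> 2 * G / lam * (1 / (D + b))"
  proof (rule mult_left_mono)
    have "(D - b) * (D + b) \<le> D\<^sup>2" by (simp add: algebra_simps power2_eq_square)
    then show "(D - b) / D\<^sup>2 \<le> 1 / (D + b)" using D b_pos by (simp add: divide_simps)
  qed (use G_pos lam_pos in simp)
  finally show ?case by (simp add: D_def algebra_simps)
qed

text \<open>The condition on \<open>T0\<close> is the sublinear bound set to at most
  \<open>\<epsilon> / 2\<close> and solved for the number of steps; the maximum with 0 ensures that
  the burn-in is over.\<close>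

lemma half_accuracy:
  assumes t0: "e t0 \<le> G / (lam * n)" and eps: "\<epsilon> > 0"
    and T0: "real T0 \<ge> real t0 + 1 / b * max 0 (4 * G / (lam * \<epsilon>) - 2 * n)"
    and t: "T0 \<le> t"
  shows "e t \<le> \<epsilon> / 2"
proof -
  have "1 / b * max 0 (4 * G / (lam * \<epsilon>) - 2 * n) \<ge> 0" using b_pos by simp
  then have "t0 \<le> t" using T0 t by linarith
  then obtain k where k: "t = t0 + k" by (metis le_add_diff_inverse)
  have "1 / b * (4 * G / (lam * \<epsilon>) - 2 * n) \<le> 1 / b * max 0 (4 * G / (lam * \<epsilon>) - 2 * n)"
    using b_pos by (intro mult_left_mono) auto
  also have "\<dots> \<le> real k" using T0 t k by linarith
  finally have "(4 * G / (lam * \<epsilon>) - 2 * n) / b \<le> real k" by simp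
  then have "4 * G / (lam * \<epsilon>) - 2 * n \<le> real k * b"
    using b_pos by (simp only: pos_divide_le_eq)
  then have "4 * G / (lam * \<epsilon>) \<le> 2 * n + b * real k" by (simp add: mult.commute)
  moreover have Q: "0 < 2 * n + b * real k" using n_pos b_pos by (simp add: add_pos_nonneg)
  ultimately have "4 * G \<le> (2 * n + b * real k) * (lam * \<epsilon>)"
    using lam_pos eps by (simp add: pos_divide_le_eq)
  then have "2 * G / (lam * (2 * n + b * real k)) \<le> \<epsilon> / 2"
    using mult_pos_pos[OF lam_pos Q] by (simp only: pos_divide_le_eq) (simp add: algebra_simps)
  then show ?thesis using sublinear_rate[OF t0, of k] k by simp
qed

end

section \<open>Random iterates\<close>

locale sdca_run = minibatch_sdca X lam L \<phi> v q + iid_sampling M S q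
  for X :: "real^'d^'n"
    and lam L :: real
    and \<phi> :: "'n \<Rightarrow> real \<Rightarrow> real"
    and v :: "real^'n"
    and q :: "'n set pmf"
    and M :: "'w measure"
    and S :: "nat \<Rightarrow> 'w \<Rightarrow> 'n set" +
  assumes loss_nonneg: "\<And>i a. \<phi> i a \<ge> 0"
begin

abbreviation iterate :: "nat \<Rightarrow> 'w \<Rightarrow> real^'n" where
  "iterate t \<omega> \<equiv> sdca X lam \<phi> v (\<lambda>k. S k \<omega>) t"

text \<open>Non-negative losses have a conjugate at 0 that is at most 0. This starts the feasibility
  induction and gives the finite dual value that any maximiser must match.\<close>

lemma zero_feasible: "0 \<in> feasible"
  unfolding feasible_def using loss_nonneg by (auto intro!: conjugate_domainI[where r = 0])

lemma feasible_sdca: "sdca X lam \<phi> v s t \<in> feasible"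
proof (induction t)
  case (Suc t)
  then show ?case using feasible_sdca_step[OF Suc, of "s t"] by (simp add: sdca_step_def)
qed (simp add: zero_feasible)

lemma integrable_iterate: "integrable M (\<lambda>\<omega>. f (iterate t \<omega>))" for f :: "real^'n \<Rightarrow> real"
  using integrable_history[OF depends_below_comp[OF depends_below_sdca]] .

definition mean_dual :: "nat \<Rightarrow> real" where
  "mean_dual t = expectation (\<lambda>\<omega>. real_dual (iterate t \<omega>))"

definition mean_gap :: "nat \<Rightarrow> real" where
  "mean_gap t = expectation (\<lambda>\<omega>. gap (iterate t \<omega>))"

lemma mean_progress:
  assumes s: "0 \<le> s" "s \<le> 1"
  shows "mean_dual t + inclusion_prob * (s * mean_gap t - s\<^sup>2 * slack_const / (2 * lam * real CARD('n)))
    \<le> mean_dual (Suc t)"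
proof -
  let ?c = "s\<^sup>2 * slack_const / (2 * lam * real CARD('n))"
  have dep: "depends_below t (\<lambda>s A. real_dual (sdca_step (sdca X lam \<phi> v s t) A))"
    by (rule depends_below_comp[OF depends_below_sdca])
  have "mean_dual t + inclusion_prob * (s * mean_gap t - ?c)
      = expectation (\<lambda>\<omega>. real_dual (iterate t \<omega>) + inclusion_prob * (s * gap (iterate t \<omega>) - ?c))"
    unfolding mean_dual_def mean_gap_def
    by (simp add: integrable_iterate prob_space)
  also have "\<dots> \<le> expectation (\<lambda>\<omega>. measure_pmf.expectation q (\<lambda>A. real_dual (sdca_step (iterate t \<omega>) A)))"
    by (intro integral_mono expected_progress feasible_sdca s)
      (rule integrable_iterate[of "\<lambda>\<alpha>. real_dual \<alpha> + inclusion_prob * (s * gap \<alpha> - ?c)"]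
        integrable_iterate[of "\<lambda>\<alpha>. measure_pmf.expectation q (\<lambda>A. real_dual (sdca_step \<alpha> A))"])+
  \<comment> \<open>The average over a fresh batch becomes the batch actually drawn, since the
    iterate depends only on earlier ones.\<close>
  also have "\<dots> = expectation (\<lambda>\<omega>. real_dual (sdca_step (iterate t \<omega>) (S t \<omega>)))"
    by (rule expectation_next_sample[OF dep, symmetric])
  also have "\<dots> = mean_dual (Suc t)"
    by (simp add: mean_dual_def sdca_step_def)
  finally show ?thesis .
qed

lemma sum_mean_gap_le:
  assumes s: "0 \<le> s" "s \<le> 1" and "T0 \<le> T"
  shows "inclusion_prob * (s * (\<Sum>t\<in>{T0..<T}. mean_gap t)
      - (real T - real T0) * (s\<^sup>2 * slack_const / (2 * lam * real CARD('n))))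
    \<le> mean_dual T - mean_dual T0"
proof -
  define c where "c = s\<^sup>2 * slack_const / (2 * lam * real CARD('n))"
  have progress: "mean_dual t + inclusion_prob * (s * mean_gap t - c) \<le> mean_dual (Suc t)" for t
    using mean_progress[OF s] by (simp add: c_def)
  have "inclusion_prob * (s * (\<Sum>t\<in>{T0..<T}. mean_gap t) - (real T - real T0) * c) \<le> mean_dual T - mean_dual T0"
    using \<open>T0 \<le> T\<close>
  proof (induction T rule: dec_induct)
    case (step T)
    then show ?case using progress[of T] by (simp add: algebra_simps)
  qed simp
  then show ?thesis by (simp add: c_def)
qed

text \<open>Weak duality for \<open>\<alpha>s\<close> at the primal point of each iterate. It turns
  progress in the gap into a recursion in the suboptimality alone.\<close>

lemma mean_gap_ge:
  assumes "\<alpha>s \<in> feasible"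
  shows "real_dual \<alpha>s - mean_dual t \<le> mean_gap t"
proof -
  have "real_dual \<alpha>s - mean_dual t = expectation (\<lambda>\<omega>. real_dual \<alpha>s - real_dual (iterate t \<omega>))"
    by (simp add: mean_dual_def integrable_iterate prob_space)
  also have "\<dots> \<le> mean_gap t"
    unfolding mean_gap_def
  proof (rule integral_mono)
    show "real_dual \<alpha>s - real_dual (iterate t \<omega>) \<le> gap (iterate t \<omega>)" for \<omega>
      using weak_duality[OF assms] by (simp add: gap_def)
  qed (simp_all add: integrable_iterate)
  finally show ?thesis .
qed

lemma sdca_average_eq_sum:
  "sdca_average X lam \<phi> v s T0 T
    = (\<Sum>t\<in>{T0..<T}. (1 / (real T - real T0)) *\<^sub>R sdca X lam \<phi> v s t)"
  by (simp add: sdca_average_def scaleR_sum_right)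

lemma feasible_sdca_average:
  assumes "T0 < T"
  shows "sdca_average X lam \<phi> v s T0 T \<in> feasible"
  unfolding sdca_average_eq_sum using assms
  by (intro convex_sum convex_feasible feasible_sdca) (auto simp: of_nat_diff)

lemma integrable_sdca_average:
  "integrable M (\<lambda>\<omega>. f (sdca_average X lam \<phi> v (\<lambda>k. S k \<omega>) T0 T))" for f :: "real^'n \<Rightarrow> real"
proof (rule integrable_history)
  have "depends_below T (\<lambda>s. sdca_average X lam \<phi> v s T0 T)"
    unfolding depends_below_def
  proof (intro allI impI)
    fix s s' :: "nat \<Rightarrow> 'n set"
    assume "\<forall>k<T. s k = s' k"
    then have "sdca X lam \<phi> v s t = sdca X lam \<phi> v s' t" if "t \<in> {T0..<T}" for t
      using that depends_below_sdca[of t X lam \<phi> v] unfolding depends_below_def by simp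
    then show "sdca_average X lam \<phi> v s T0 T = sdca_average X lam \<phi> v s' T0 T"
      unfolding sdca_average_def by simp
  qed
  then show "depends_below T (\<lambda>s. f (sdca_average X lam \<phi> v s T0 T))"
    by (rule depends_below_comp)
qed

lemma gap_average_le:
  assumes "T0 < T"
  shows "expectation (\<lambda>\<omega>. gap (sdca_average X lam \<phi> v (\<lambda>k. S k \<omega>) T0 T))
    \<le> 1 / (real T - real T0) * (\<Sum>t\<in>{T0..<T}. mean_gap t)"
proof -
  let ?c = "1 / (real T - real T0)"
  have "gap (sdca_average X lam \<phi> v s T0 T) \<le> (\<Sum>t\<in>{T0..<T}. ?c * gap (sdca X lam \<phi> v s t))" for s
    unfolding sdca_average_eq_sum using assms
    by (intro convex_on_sum[OF _ _ convex_on_gap] feasible_sdca) (auto simp: of_nat_diff)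
  then have "expectation (\<lambda>\<omega>. gap (sdca_average X lam \<phi> v (\<lambda>k. S k \<omega>) T0 T))
      \<le> expectation (\<lambda>\<omega>. \<Sum>t\<in>{T0..<T}. ?c * gap (iterate t \<omega>))"
    by (intro integral_mono integrable_sdca_average Bochner_Integration.integrable_sum
        integrable_mult_right integrable_iterate)
  also have "\<dots> = (\<Sum>t\<in>{T0..<T}. ?c * mean_gap t)"
    unfolding mean_gap_def
    by (subst Bochner_Integration.integral_sum)
      (auto intro!: integrable_mult_right integrable_iterate)
  finally show ?thesis unfolding sum_distrib_left .
qed

context
  fixes \<alpha>s :: "real^'n"
  assumes dual_max: "is_arg_max (dual X lam \<phi>) (\<lambda>_. True) \<alpha>s"
    and L_pos: "L > 0"
begin

lemma dual_le_max: "dual X lam \<phi> \<alpha> \<le> dual X lam \<phi> \<alpha>s"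
  using dual_max by (simp add: is_arg_max_def not_less)

lemma maximizer_feasible: "\<alpha>s \<in> feasible"
proof (rule ccontr)
  assume "\<alpha>s \<notin> feasible"
  then show False using dual_le_max[of 0] by (simp add: dual_infeasible dual_feasible[OF zero_feasible])
qed

lemma real_dual_le_max: "\<alpha> \<in> feasible \<Longrightarrow> real_dual \<alpha> \<le> real_dual \<alpha>s"
  using dual_le_max[of \<alpha>] by (simp add: dual_feasible maximizer_feasible)

lemma mean_dual_le_max: "mean_dual t \<le> real_dual \<alpha>s"
proof -
  have "mean_dual t \<le> expectation (\<lambda>\<omega>. real_dual \<alpha>s)"
    unfolding mean_dual_def
    by (intro integral_mono real_dual_le_max feasible_sdca integrable_iterate)
  then show ?thesis by (simp add: prob_space)
qed

lemma initial_dual_gap_eq: "initial_dual_gap X lam \<phi> \<alpha>s = real_dual \<alpha>s - mean_dual 0"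
  by (simp add: initial_dual_gap_def mean_dual_def dual_feasible maximizer_feasible zero_feasible
      prob_space)

lemma suboptimality_rate:
  "sdca_rate (\<lambda>t. real_dual \<alpha>s - mean_dual t) (real CARD('n)) (batch_size q) slack_const lam"
proof
  fix t :: nat and s :: real
  assume s: "0 \<le> s" "s \<le> 1"
  define p where "p = batch_size q / real CARD('n)"
  define c where "c = s\<^sup>2 * slack_const / (2 * lam * real CARD('n))"
  have "p * (s * (real_dual \<alpha>s - mean_dual t) - c) \<le> p * (s * mean_gap t - c)"
    using s batch_pos mean_gap_ge[OF maximizer_feasible, of t]
    by (intro mult_left_mono diff_right_mono) (auto simp: p_def)
  also have "\<dots> \<le> mean_dual (Suc t) - mean_dual t"
    using mean_progress[OF s, of t] unfolding inclusion_prob_def p_def c_def by linarith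
  finally show "real_dual \<alpha>s - mean_dual (Suc t) \<le> (1 - s * p) * (real_dual \<alpha>s - mean_dual t) + p * c"
    by (simp add: algebra_simps)
next
  show "batch_size q \<le> real CARD('n)"
    using inclusion_prob_le_1 by (simp add: inclusion_prob_def)
  show "0 < slack_const"
    unfolding slack_const_def using L_pos v_pos by (auto intro!: mult_pos_pos divide_pos_pos sum_pos)
  show "0 \<le> real_dual \<alpha>s - mean_dual 0" using mean_dual_le_max[of 0] by simp
qed (use batch_pos lam_pos in auto)

lemma averaged_gap_le:
  assumes half: "real_dual \<alpha>s - mean_dual T0 \<le> \<epsilon> / 2" and "\<epsilon> > 0"
    and K: "real T \<ge> real T0 + max (real_of_int \<lceil>real CARD('n) / batch_size q\<rceil>)
      (1 / batch_size q * (slack_const / (lam * \<epsilon>)))"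
  shows "expectation (\<lambda>\<omega>. gap (sdca_average X lam \<phi> v (\<lambda>k. S k \<omega>) T0 T)) \<le> \<epsilon>"
proof -
  let ?n = "real CARD('n)" and ?b = "batch_size q"
  define k where "k = real T - real T0"
  have k1: "?n / ?b \<le> k" and k2: "1 / ?b * (slack_const / (lam * \<epsilon>)) \<le> k"
    using K unfolding k_def by linarith+
  have "0 < ?n / ?b" using batch_pos by simp
  then have k: "0 < k" using k1 by linarith
  then have T: "T0 < T" by (simp add: k_def)
  \<comment> \<open>Then \<open>inclusion_prob * s\<close> is \<open>1 / k\<close>, so the weighted
    sum of gaps is their average; the term \<open>\<lceil>n / b\<rceil>\<close> in the condition on
    \<open>T\<close> gives \<open>s \<le> 1\<close>.\<close>
  define s where "s = ?n / (?b * k)"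
  have s: "0 \<le> s" "s \<le> 1"
    using k k1 batch_pos by (auto simp: s_def field_simps)
  define Z where "Z = (\<Sum>t\<in>{T0..<T}. mean_gap t)"
  have "inclusion_prob * (s * Z - k * (s\<^sup>2 * slack_const / (2 * lam * ?n))) \<le> mean_dual T - mean_dual T0"
    using sum_mean_gap_le[OF s, of T0 T] T by (simp add: Z_def k_def)
  \<comment> \<open>The total dual increase from \<open>T0\<close> on is at most the suboptimality
    at \<open>T0\<close>. The other half of \<open>\<epsilon>\<close> pays for the slack term
    below.\<close>
  also have "\<dots> \<le> \<epsilon> / 2" using half mean_dual_le_max[of T] by simp
  also have "inclusion_prob * (s * Z - k * (s\<^sup>2 * slack_const / (2 * lam * ?n)))
      = 1 / k * Z - slack_const / (2 * lam * ?b * k)"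
    using k batch_pos lam_pos by (simp add: inclusion_prob_def s_def field_simps power2_eq_square)
  finally have "1 / k * Z \<le> \<epsilon> / 2 + slack_const / (2 * lam * ?b * k)" by linarith
  moreover have "slack_const / (2 * lam * ?b * k) \<le> \<epsilon> / 2"
  proof -
    have "slack_const / (?b * (lam * \<epsilon>)) \<le> k" using k2 by simp
    then have "slack_const \<le> k * (?b * (lam * \<epsilon>))"
      using batch_pos lam_pos \<open>\<epsilon> > 0\<close> by (simp add: pos_divide_le_eq)
    then have "slack_const \<le> \<epsilon> / 2 * (2 * lam * ?b * k)" by (simp add: algebra_simps)
    moreover have "0 < 2 * lam * ?b * k" using batch_pos lam_pos k by simp
    ultimately show ?thesis by (simp only: pos_divide_le_eq)
  qed
  ultimately show ?thesis using gap_average_le[OF T] unfolding Z_def k_def by linarith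
qed

end

end

text \<open>The guard in \<open>t0_ge\<close> encodes the logarithm of 0 as minus infinity; what
  remains then, \<open>t0 \<ge> 0\<close>, is automatic for a natural number.\<close>

theorem theorem3:
  fixes X :: "real^'d^'n"
    and lam L \<epsilon> :: real
    and \<phi> :: "'n \<Rightarrow> real \<Rightarrow> real"
    and v \<alpha>s :: "real^'n"
    and Shat :: "'n set pmf"
    and M :: "'w measure"
    and S :: "nat \<Rightarrow> 'w \<Rightarrow> 'n set"
    and t0 T0 T :: nat
    and n b G \<epsilon>0 :: real
    and \<alpha> :: "nat \<Rightarrow> 'w \<Rightarrow> real^'n"
    and \<alpha>bar :: "'w \<Rightarrow> real^'n"
    and wbar :: "'w \<Rightarrow> real^'d"
  defines "n \<equiv> real CARD('n)"
    and "b \<equiv> batch_size Shat"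
    and "G \<equiv> 4 * L\<^sup>2 * ((\<Sum>i\<in>UNIV. v $ i) / n)"
    and "\<epsilon>0 \<equiv> initial_dual_gap X lam \<phi> \<alpha>s"
    and "\<alpha> \<equiv> \<lambda>t \<omega>. sdca X lam \<phi> v (\<lambda>k. S k \<omega>) t"
    and "\<alpha>bar \<equiv> \<lambda>\<omega>. sdca_average X lam \<phi> v (\<lambda>k. S k \<omega>) T0 T"
    and "wbar \<equiv> \<lambda>\<omega>. primal_of_dual X lam (\<alpha>bar \<omega>)"
  assumes lam_pos: "lam > 0"
    and loss_convex: "\<And>i. convex_on UNIV (\<phi> i)"
    and loss_nonneg: "\<And>i a. \<phi> i a \<ge> 0"
    and loss_zero: "\<And>i. \<phi> i 0 \<le> 1"
    and L_pos: "L > 0"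
    and loss_Lipschitz: "\<And>i a c. \<bar>\<phi> i a - \<phi> i c\<bar> \<le> L * \<bar>a - c\<bar>"
    and sampling_uniform: "uniform_sampling Shat"
    and b_pos: "b > 0"
    and v_pos: "\<And>i. v $ i > 0"
    and eso: "ESO X lam Shat v"
    and prob: "prob_space M"
    and S_indep: "prob_space.indep_vars M (\<lambda>_. count_space UNIV) S UNIV"
    and S_distr: "\<And>t. distr M (count_space UNIV) (S t) = measure_pmf Shat"
    and dual_max: "is_arg_max (dual X lam \<phi>) (\<lambda>_. True) \<alpha>s"
    and eps_pos: "\<epsilon> > 0"
    and t0_ge: "\<epsilon>0 \<noteq> 0 \<Longrightarrow> int t0 \<ge> max 0 \<lceil>n / b * ln (2 * lam * n * \<epsilon>0 / G)\<rceil>"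
    and T0_ge: "real T0 \<ge> real t0 + 1 / b * max 0 (4 * G / (lam * \<epsilon>) - 2 * n)"
    and T_ge: "real T \<ge> real T0 + max (real_of_int \<lceil>n / b\<rceil>) (1 / b * (G / (lam * \<epsilon>)))"
  shows "ereal_expectation M (\<lambda>\<omega>. ereal (primal X lam \<phi> (wbar \<omega>)) - dual X lam \<phi> (\<alpha>bar \<omega>)) \<le> ereal \<epsilon>
    \<and> (\<forall>t\<ge>T0. ereal_expectation M (\<lambda>\<omega>. dual X lam \<phi> \<alpha>s - dual X lam \<phi> (\<alpha> t \<omega>)) \<le> ereal (\<epsilon> / 2))"
proof -
  interpret prob_space M by (rule prob)
  interpret sdca_run X lam L \<phi> v Shat M S
    using lam_pos loss_convex loss_nonneg loss_Lipschitz sampling_uniform b_pos v_pos eso S_indep S_distr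
    unfolding b_def by unfold_locales
  have G: "G = slack_const" by (simp add: G_def n_def slack_const_def)
  interpret rate: sdca_rate "\<lambda>t. real_dual \<alpha>s - mean_dual t" n b G lam
    unfolding n_def b_def G by (rule suboptimality_rate[OF dual_max L_pos])
  have \<epsilon>0: "\<epsilon>0 = real_dual \<alpha>s - mean_dual 0"
    unfolding \<epsilon>0_def by (rule initial_dual_gap_eq[OF dual_max L_pos])
  have half: "real_dual \<alpha>s - mean_dual t \<le> \<epsilon> / 2" if "T0 \<le> t" for t
    using rate.half_accuracy[OF rate.burn_in eps_pos T0_ge that] t0_ge unfolding \<epsilon>0 by blast
  \<comment> \<open>Makes the averaging window nonempty, so the average is a genuine convex
    combination and hence feasible.\<close>
  have "0 < n / b" using b_pos by (simp add: n_def)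
  then have T: "T0 < T" using T_ge by linarith
  have "ereal (primal X lam \<phi> (wbar \<omega>)) - dual X lam \<phi> (\<alpha>bar \<omega>) = ereal (gap (\<alpha>bar \<omega>))" for \<omega>
    using feasible_sdca_average[OF T] by (simp add: \<alpha>bar_def wbar_def gap_def dual_feasible)
  then have "ereal_expectation M (\<lambda>\<omega>. ereal (primal X lam \<phi> (wbar \<omega>)) - dual X lam \<phi> (\<alpha>bar \<omega>))
      = ereal (expectation (\<lambda>\<omega>. gap (\<alpha>bar \<omega>)))"
    unfolding \<alpha>bar_def by (simp add: ereal_expectation_eq_integral integrable_sdca_average)
  moreover have "expectation (\<lambda>\<omega>. gap (\<alpha>bar \<omega>)) \<le> \<epsilon>"
    unfolding \<alpha>bar_def using T_ge
    by (intro averaged_gap_le[OF dual_max L_pos half eps_pos]) (auto simp: G n_def b_def)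
  moreover have "ereal_expectation M (\<lambda>\<omega>. dual X lam \<phi> \<alpha>s - dual X lam \<phi> (\<alpha> t \<omega>)) \<le> ereal (\<epsilon> / 2)"
    if "T0 \<le> t" for t
  proof -
    have "dual X lam \<phi> \<alpha>s - dual X lam \<phi> (\<alpha> t \<omega>) = ereal (real_dual \<alpha>s - real_dual (\<alpha> t \<omega>))" for \<omega>
      by (simp add: \<alpha>_def dual_feasible feasible_sdca maximizer_feasible[OF dual_max L_pos])
    then have "ereal_expectation M (\<lambda>\<omega>. dual X lam \<phi> \<alpha>s - dual X lam \<phi> (\<alpha> t \<omega>))
        = ereal (real_dual \<alpha>s - mean_dual t)"
      unfolding \<alpha>_def
      by (simp add: ereal_expectation_eq_integral integrable_iterate mean_dual_def prob_space.prob_space[OF prob])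
    then show ?thesis using half[OF that] by simp
  qed
  ultimately show ?thesis by simp
qed

end
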